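(* Let $\Gamma$ be a simple graph on $V=\{1,\dots,n\}$ with edge ideal $I\subseteq R=k[x_1,\dots,x_n]$, let $t\ge 1$ be an integer and let $\mathbf a\in\mathbb N^n$. Then $x^{\mathbf a}\in \widetilde{I^t}\setminus I^t$ if and only if the following two conditions are satisfied: (i) $\nu(\Gamma_{\mathbf a})<t$; (ii) $\nu(\Gamma_{\mathbf a}-N_{\mathbf a}(i))\ge t-\deg_{\mathbf a}(i)$ for all $i\in V$.
   Context: $k$ is a field, $n\ge 1$, $\mathfrak m=(x_1,\dots,x_n)$. The edge ideal of a simple graph $\Gamma$ on $V=\{1,\dots,n\}$ is the ideal $I$ generated by the monomials $x_ix_j$ with $\{i,j\}$ an edge of $\Gamma$. For $\mathbf a=(a_1,\dots,a_n)\in\mathbb N^n$, $x^{\mathbf a}=x_1^{a_1}\cdots x_n^{a_n}$. The saturation of an ideal $J$ of $R$ is $\widetilde J=\bigcup_{m\ge 1}(J:\mathfrak m^m)$. A weighted graph is a simple graph (its base graph) whose vertices are assigned positive integers, called weights. A matching of a weighted graph $\Omega$ is a family of edges (not necessarily different) such that every vertex of $\Omega$ appears in these edges no more times than its weight. The matching number $\nu(\Omega)$ is the maximal number of edges (counted with multiplicity) of a matching of $\Omega$ ($0$ if there are no edges). For a set $N$ of vertices, $\Omega-N$ is the induced weighted subgraph on the vertices not in $N$ (with the same weights). For $\mathbf a\in\mathbb N^n$ let $V_{\mathbf a}=\{i\in V\mid a_i>0\}$; $\Gamma_{\mathbf a}$ is the weighted graph whose base graph is the subgraph of $\Gamma$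 induced on $V_{\mathbf a}$ and where $i\in V_{\mathbf a}$ has weight $a_i$. For any $i\in V$, $N_{\mathbf a}(i)$ is the set of vertices of $V_{\mathbf a}$ adjacent to $i$ in $\Gamma$, and $\deg_{\mathbf a}(i)=\sum_{j\in N_{\mathbf a}(i)}a_j$. *)

theory Defs
  imports Complex_Main "HOL-Library.Poly_Mapping" "HOL-Library.Multiset"
begin

section \<open>Ideals of a commutative ring\<close>

text \<open>
  A commutative ring is a module over itself. The subspaces of this module are the ideals, and
  \<open>ring_ideal.span S\<close> is the ideal generated by \<open>S\<close>.
\<close>

interpretation ring_ideal: module "(*) :: 'a::comm_ring_1 \<Rightarrow> 'a \<Rightarrow> 'a"
  by unfold_locales (simp_all add: algebra_simps)

definition ideal_mult :: "'a::comm_ring_1 set \<Rightarrow> 'a set \<Rightarrow> 'a set" where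
  "ideal_mult I J = ring_ideal.span {f * g | f g. f \<in> I \<and> g \<in> J}"

primrec ideal_power :: "'a::comm_ring_1 set \<Rightarrow> nat \<Rightarrow> 'a set" where
  "ideal_power I 0 = UNIV"
| "ideal_power I (Suc t) = ideal_mult I (ideal_power I t)"

definition ideal_quotient :: "'a::comm_ring_1 set \<Rightarrow> 'a set \<Rightarrow> 'a set" where
  "ideal_quotient J K = {f. \<forall>g\<in>K. f * g \<in> J}"


section \<open>Polynomial rings in finitely many variables\<close>

text \<open>
  With \<open>'n\<close> a finite type, \<open>('n, 'k) mpoly\<close> is the polynomial ring over \<open>'k\<close> in the
  \<open>CARD('n)\<close> variables indexed by the elements of \<open>'n\<close>; a polynomial maps each exponent
  vector to its coefficient.
\<close>

type_synonym ('n, 'k) mpoly = "('n \<Rightarrow>\<^sub>0 nat) \<Rightarrow>\<^sub>0 'k"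

definition var :: "'n \<Rightarrow> ('n, 'k::comm_ring_1) mpoly" where
  "var i = Poly_Mapping.single (Poly_Mapping.single i 1) 1"

definition monomial :: "('n::finite \<Rightarrow> nat) \<Rightarrow> ('n, 'k::comm_ring_1) mpoly" where
  "monomial a = (\<Prod>i\<in>UNIV. var i ^ a i)"

definition max_ideal :: "('n::finite, 'k::comm_ring_1) mpoly set" where
  "max_ideal = ring_ideal.span {var i | i. True}"

definition saturation ::
    "('n::finite, 'k::comm_ring_1) mpoly set \<Rightarrow> ('n, 'k) mpoly set" where
  "saturation J = (\<Union>m\<in>{1..}. ideal_quotient J (ideal_power max_ideal m))"


section \<open>Graphs and weighted graphs\<close>

record 'v graph =
  verts :: "'v set"
  edges :: "'v set set"

record 'v wgraph = "'v graph" +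
  weight :: "'v \<Rightarrow> nat"

definition simple_graph :: "('v, 'z) graph_scheme \<Rightarrow> bool" where
  "simple_graph G \<longleftrightarrow> finite (verts G) \<and> (\<forall>e\<in>edges G. e \<subseteq> verts G \<and> card e = 2)"

definition weighted_graph :: "'v wgraph \<Rightarrow> bool" where
  "weighted_graph W \<longleftrightarrow> simple_graph W \<and> (\<forall>v\<in>verts W. weight W v > 0)"

definition edge_ideal :: "'n::finite graph \<Rightarrow> ('n, 'k::comm_ring_1) mpoly set" where
  "edge_ideal G = ring_ideal.span {var i * var j | i j. {i, j} \<in> edges G}"

definition is_matching :: "'v wgraph \<Rightarrow> 'v set multiset \<Rightarrow> bool" where
  "is_matching W M \<longleftrightarrow>
     set_mset M \<subseteq> edges W \<and> (\<forall>v\<in>verts W. size {#e \<in># M. v \<in> e#} \<le> weight W v)"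

text \<open>The maximum exists for weighted graphs, see \<open>finite_matching_sizes\<close> below.\<close>

definition matching_number :: "'v wgraph \<Rightarrow> nat" where
  "matching_number W = Max {size M | M. is_matching W M}"

definition remove_verts :: "'v wgraph \<Rightarrow> 'v set \<Rightarrow> 'v wgraph" where
  "remove_verts W N =
     W\<lparr>verts := verts W - N, edges := {e \<in> edges W. e \<subseteq> verts W - N}\<rparr>"

definition supp_verts :: "'v graph \<Rightarrow> ('v \<Rightarrow> nat) \<Rightarrow> 'v set" where
  "supp_verts G a = {i \<in> verts G. a i > 0}"

definition weighted_subgraph :: "'v graph \<Rightarrow> ('v \<Rightarrow> nat) \<Rightarrow> 'v wgraph" where
  "weighted_subgraph G a =
     \<lparr>verts = supp_verts G a, edges = {e \<in> edges G. e \<subseteq> supp_verts G a}, weight = a\<rparr>"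

definition supp_nbhd :: "'v graph \<Rightarrow> ('v \<Rightarrow> nat) \<Rightarrow> 'v \<Rightarrow> 'v set" where
  "supp_nbhd G a i = {j \<in> supp_verts G a. {i, j} \<in> edges G}"

definition wdegree :: "'v graph \<Rightarrow> ('v \<Rightarrow> nat) \<Rightarrow> 'v \<Rightarrow> nat" where
  "wdegree G a i = (\<Sum>j\<in>supp_nbhd G a i. a j)"

lemma weighted_graph_weighted_subgraph:
  "simple_graph G \<Longrightarrow> weighted_graph (weighted_subgraph G a)"
  by (auto simp: weighted_graph_def simple_graph_def weighted_subgraph_def supp_verts_def)

lemma weighted_graph_remove_verts:
  "weighted_graph W \<Longrightarrow> weighted_graph (remove_verts W N)"
  by (auto simp: weighted_graph_def simple_graph_def remove_verts_def)

lemma finite_matching_sizes: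
  assumes "weighted_graph W"
  shows "finite {size M | M. is_matching W M}"
proof -
  have fin: "finite (verts W)"
    using assms by (simp add: weighted_graph_def simple_graph_def)
  have "size M \<le> (\<Sum>v\<in>verts W. weight W v)" if M: "is_matching W M" for M
  proof -
    have "size N \<le> (\<Sum>v\<in>verts W. size {#e \<in># N. v \<in> e#})" if "set_mset N \<subseteq> edges W" for N
      using that
    proof (induction N)
      case empty
      then show ?case by simp
    next
      case (add e N)
      then have e: "e \<subseteq> verts W" "card e = 2"
        using assms by (auto simp: weighted_graph_def simple_graph_def)
      then have "e \<noteq> {}" by auto
      then obtain u where u: "u \<in> e" "u \<in> verts W" using e(1) by blast
      have "(\<Sum>v\<in>verts W. size {#f \<in># N. v \<in> f#}) < (\<Sum>v\<in>verts W. size {#f \<in># add_mset e N. v \<in> f#})"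
        using fin u by (intro sum_strict_mono_ex1) auto
      with add show ?case by simp
    qed
    also have "(\<Sum>v\<in>verts W. size {#e \<in># M. v \<in> e#}) \<le> (\<Sum>v\<in>verts W. weight W v)"
      using M by (intro sum_mono) (auto simp: is_matching_def)
    finally show ?thesis using M by (simp add: is_matching_def)
  qed
  then have "{size M | M. is_matching W M} \<subseteq> {..(\<Sum>v\<in>verts W. weight W v)}"
    by blast
  then show ?thesis
    by (rule finite_subset) simp
qed

end

theory Submission
  imports Defs
begin

text \<open>
  Membership of a polynomial in \<open>I\<^sup>t\<close> is decided on its exponent vectors: \<open>x\<^sup>u \<in> I\<^sup>t\<close> iff some
  \<open>t\<close> edges, counted with multiplicity, cover each vertex \<open>v\<close> at most \<open>u v\<close> times. Hence \<open>x\<^sup>a\<close>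
  lies in the saturation iff for every \<open>i\<close> there are \<open>t\<close> edges respecting the bounds given by
  \<open>a\<close> at all vertices other than \<open>i\<close>. Once the bound at \<open>i\<close> is dropped, an optimal choice
  saturates the neighbours of \<open>i\<close> with edges to \<open>i\<close>, which contributes the degree of \<open>i\<close>, and
  takes a maximum matching of the rest.
\<close>

abbreviation "keys \<equiv> Poly_Mapping.keys"
abbreviation "lookup \<equiv> Poly_Mapping.lookup"
abbreviation "single \<equiv> Poly_Mapping.single"

section \<open>Multisets of edges and their vertex degrees\<close>

definition cover_deg :: "'v set multiset \<Rightarrow> 'v \<Rightarrow> nat" where
  "cover_deg M v = size {#e \<in># M. v \<in> e#}"

lemma cover_deg_empty [simp]: "cover_deg {#} v = 0"
  and cover_deg_add_mset [simp]:
    "cover_deg (add_mset e M) v = (if v \<in> e then 1 else 0) + cover_deg M v"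
  and cover_deg_union [simp]: "cover_deg (M + N) v = cover_deg M v + cover_deg N v"
  by (simp_all add: cover_deg_def)

lemma cover_deg_sum: "cover_deg (sum f A) v = (\<Sum>x\<in>A. cover_deg (f x) v)"
  by (induction A rule: infinite_finite_induct) simp_all

lemma cover_deg_replicate: "cover_deg (replicate_mset n e) v = (if v \<in> e then n else 0)"
  by (induction n) simp_all

lemma cover_deg_mono: "M \<subseteq># N \<Longrightarrow> cover_deg M v \<le> cover_deg N v"
  by (auto simp: cover_deg_def intro!: size_mset_mono multiset_filter_mono)

lemma cover_deg_le_size: "cover_deg M v \<le> size M"
  by (simp add: cover_deg_def)

lemma cover_deg_pos: "e \<in># M \<Longrightarrow> v \<in> e \<Longrightarrow> cover_deg M v > 0"
  by (auto simp: cover_deg_def nonempty_has_size[symmetric])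

lemma cover_deg_eq_0: "(\<And>e. e \<in># M \<Longrightarrow> v \<notin> e) \<Longrightarrow> cover_deg M v = 0"
  by (simp add: cover_deg_def)

text \<open>Double counting: every member of \<open>M\<close> contains a vertex of \<open>N\<close>,
  so it contributes at least 1 to the sum on the right.\<close>

lemma size_le_sum_cover_deg:
  assumes "finite N" and "\<And>e. e \<in># M \<Longrightarrow> e \<inter> N \<noteq> {}"
  shows "size M \<le> (\<Sum>v\<in>N. cover_deg M v)"
  using assms(2)
proof (induction M)
  case empty
  then show ?case by simp
next
  case (add e M)
  have "e \<inter> N \<noteq> {}"
    by (rule add.prems) simp
  then obtain w where w: "w \<in> e" "w \<in> N" by blast
  then have "(if w \<in> e then 1 else 0 :: nat) \<le> (\<Sum>v\<in>N. if v \<in> e then 1 else 0)"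
    by (intro member_le_sum) (use assms(1) in auto)
  then have "1 \<le> (\<Sum>v\<in>N. if v \<in> e then 1 else 0 :: nat)"
    using w(1) by (simp only: if_True)
  moreover have "size M \<le> (\<Sum>v\<in>N. cover_deg M v)"
    by (rule add.IH) (simp add: add.prems)
  ultimately show ?case
    by (simp only: size_add_mset cover_deg_add_mset sum.distrib)
qed

text \<open>Serves to trim a family with too many edges to exactly the required number.\<close>

lemma exists_submultiset_size:
  assumes "n \<le> size M"
  shows "\<exists>N. N \<subseteq># M \<and> size N = n"
  using assms
proof (induction M)
  case (add x M)
  then show ?case
  proof (cases "n = Suc (size M)")
    case False
    with add obtain N where "N \<subseteq># M" "size N = n" by auto
    then show ?thesis using subset_mset.order_trans[of N M "add_mset x M"] by auto
  qed auto
qed simp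

text \<open>In a simple graph, the product of the edge monomials of \<open>M\<close> has exponent
  \<open>cover_deg M v\<close> at \<open>v\<close>. The condition is thus divisibility of the
  monomial with exponents \<open>u\<close> by a product of \<open>t\<close> generators of the edge
  ideal.\<close>

definition edge_cover :: "'v graph \<Rightarrow> nat \<Rightarrow> ('v \<Rightarrow> nat) \<Rightarrow> bool" where
  "edge_cover G t u \<longleftrightarrow>
     (\<exists>M. size M = t \<and> set_mset M \<subseteq> edges G \<and> (\<forall>v. cover_deg M v \<le> u v))"

lemma edge_cover_mono: "edge_cover G t u \<Longrightarrow> (\<And>v. u v \<le> w v) \<Longrightarrow> edge_cover G t w"
  unfolding edge_cover_def using order_trans by blast

lemma edge_cover_add:
  assumes "edge_cover G s u" and "edge_cover G t w"
  shows "edge_cover G (s + t) (\<lambda>v. u v + w v)"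
proof -
  obtain M N where "size M = s" "set_mset M \<subseteq> edges G" "\<forall>v. cover_deg M v \<le> u v"
    "size N = t" "set_mset N \<subseteq> edges G" "\<forall>v. cover_deg N v \<le> w v"
    using assms unfolding edge_cover_def by blast
  then show ?thesis
    unfolding edge_cover_def by (intro exI[of _ "M + N"]) (auto intro: add_mono)
qed

section \<open>Polynomials with restricted exponents\<close>

text \<open>Addition creates no new exponent vectors, and those of \<open>c * p\<close> are sums of
  one from \<open>c\<close> and one from \<open>p\<close>. An upward closed condition on exponents
  therefore cuts out an ideal.\<close>

lemma subspace_keys:
  assumes "\<And>u w. P u \<Longrightarrow> P (u + w)"
  shows "ring_ideal.subspace {p :: ('n::finite, 'k::comm_ring_1) mpoly. \<forall>u\<in>keys p. P u}"
proof (rule ring_ideal.subspaceI)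
  show "0 \<in> {p :: ('n, 'k) mpoly. \<forall>u\<in>keys p. P u}"
    by simp
next
  fix p q :: "('n, 'k) mpoly"
  assume "p \<in> {p. \<forall>u\<in>keys p. P u}" "q \<in> {p. \<forall>u\<in>keys p. P u}"
  then show "p + q \<in> {p. \<forall>u\<in>keys p. P u}"
    using Poly_Mapping.keys_add[of p q] by blast
next
  fix c p :: "('n, 'k) mpoly"
  assume "p \<in> {p. \<forall>u\<in>keys p. P u}"
  then show "c * p \<in> {p. \<forall>u\<in>keys p. P u}"
    using keys_mult[of c p] assms by (fastforce simp: add.commute)
qed

text \<open>The exponent vectors of a generator \<open>f * g\<close> are sums of one from
  \<open>f\<close> and one from \<open>g\<close>, and \<open>subspace_keys\<close> passes from
  generators to the span. This is the common induction step for powers of the edge ideal and of the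
  maximal ideal.\<close>

lemma keys_ideal_mult:
  fixes I J :: "('n::finite, 'k::comm_ring_1) mpoly set"
  assumes p: "p \<in> ideal_mult I J" and u: "u \<in> keys p"
    and I: "\<And>f v. f \<in> I \<Longrightarrow> v \<in> keys f \<Longrightarrow> P v"
    and J: "\<And>g w. g \<in> J \<Longrightarrow> w \<in> keys g \<Longrightarrow> Q w"
    and up: "\<And>u w. R u \<Longrightarrow> R (u + w)"
    and R: "\<And>v w. P v \<Longrightarrow> Q w \<Longrightarrow> R (v + w)"
  shows "R u"
proof -
  have "ideal_mult I J \<subseteq> {p. \<forall>u\<in>keys p. R u}"
    unfolding ideal_mult_def
  proof (rule ring_ideal.span_minimal)
    show "{f * g | f g. f \<in> I \<and> g \<in> J} \<subseteq> {p. \<forall>u\<in>keys p. R u}"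
      using I J R keys_mult by blast
  qed (rule subspace_keys, fact up)
  with p u show ?thesis by blast
qed

lemma subspace_ideal_power: "ring_ideal.subspace (ideal_power I t)"
  by (cases t) (simp_all add: ideal_mult_def ring_ideal.subspace_UNIV)

lemma ideal_mult_mem: "f \<in> I \<Longrightarrow> g \<in> J \<Longrightarrow> f * g \<in> ideal_mult I J"
  unfolding ideal_mult_def by (rule ring_ideal.span_base) blast

lemma power_mem_ideal_power: "f \<in> I \<Longrightarrow> f ^ m \<in> ideal_power I m"
  by (induction m) (auto intro: ideal_mult_mem)

text \<open>There are finitely many variables, so every function has finite support and
  \<open>Abs_poly_mapping\<close> loses nothing.\<close>

definition mono_exp :: "('n::finite \<Rightarrow> nat) \<Rightarrow> 'n \<Rightarrow>\<^sub>0 nat" where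
  "mono_exp a = Abs_poly_mapping a"

lemma lookup_mono_exp [simp]: "lookup (mono_exp a) = a"
  by (simp add: mono_exp_def)

lemma var_power: "var i ^ m = single (single i m) 1"
  by (induction m) (simp_all add: var_def mult_single single_add[symmetric])

lemma prod_single: "(\<Prod>i\<in>A. single (f i) 1) =
    (single (\<Sum>i\<in>A. f i) 1 :: ('b::comm_monoid_add \<Rightarrow>\<^sub>0 'k::comm_ring_1))"
  by (induction A rule: infinite_finite_induct) (simp_all add: mult_single)

lemma monomial_eq_single: "monomial a = single (mono_exp a) 1"
proof -
  have "(\<Sum>i\<in>UNIV. single i (a i)) = mono_exp a"
    by (rule poly_mapping_eqI) (simp add: lookup_sum lookup_single when_def)
  then show ?thesis
    by (simp add: monomial_def var_power prod_single)
qed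

lemma single_mem_imp_mem:
  fixes S :: "('n::finite, 'k::comm_ring_1) mpoly set"
  assumes S: "ring_ideal.subspace S"
    and p: "\<And>u. u \<in> keys p \<Longrightarrow> single u 1 \<in> S"
  shows "p \<in> S"
proof -
  have "p = (\<Sum>u\<in>keys p. single u (lookup p u))"
    by (rule poly_mapping_eqI) (simp add: lookup_sum lookup_single when_def in_keys_iff)
  \<comment> \<open>The scalars of the module are ring elements, so each coefficient is written as a
    constant polynomial.\<close>
  also have "\<dots> = (\<Sum>u\<in>keys p. single 0 (lookup p u) * single u 1)"
    by (simp add: mult_single)
  also have "\<dots> \<in> S"
    using S p by (intro ring_ideal.subspace_sum ring_ideal.subspace_scale)
  finally show ?thesis .
qed

section \<open>Powers of edge ideals\<close>

lemma keys_edge_ideal: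
  fixes f :: "('n::finite, 'k::comm_ring_1) mpoly"
  assumes "simple_graph G" and f: "f \<in> edge_ideal G" and u: "u \<in> keys f"
  shows "edge_cover G 1 (lookup u)"
proof -
  have gen: "edge_cover G 1 (lookup u)"
    if e: "{i, j} \<in> edges G" and u: "u \<in> keys (var i * var j :: ('n, 'k) mpoly)" for i j u
  proof -
    have "u = single i 1 + single j 1"
      using u by (auto simp: var_def mult_single split: if_splits)
    moreover have "i \<noteq> j"
      using assms(1) e by (auto simp: simple_graph_def)
    ultimately show ?thesis
      using e unfolding edge_cover_def
      by (intro exI[of _ "{#{i, j}#}"]) (auto simp: lookup_add lookup_single when_def)
  qed
  have "(edge_ideal G :: ('n, 'k) mpoly set) \<subseteq> {p. \<forall>u\<in>keys p. edge_cover G 1 (lookup u)}"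
    unfolding edge_ideal_def
  proof (rule ring_ideal.span_minimal)
    show "ring_ideal.subspace {p :: ('n, 'k) mpoly. \<forall>u\<in>keys p. edge_cover G 1 (lookup u)}"
      by (rule subspace_keys) (erule edge_cover_mono, simp add: lookup_add)
  qed (use gen in blast)
  with f u show ?thesis by blast
qed

text \<open>By induction on \<open>t\<close>: exponent vectors add in a product, and so do the edge
  multisets that fit below them.\<close>

lemma keys_ideal_power_edge_ideal:
  fixes p :: "('n::finite, 'k::comm_ring_1) mpoly"
  assumes "simple_graph G" and "p \<in> ideal_power (edge_ideal G) t" and "u \<in> keys p"
  shows "edge_cover G t (lookup u)"
  using assms(2,3)
proof (induction t arbitrary: p u)
  case 0
  show ?case
    unfolding edge_cover_def by (intro exI[of _ "{#}"]) simp
next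
  case (Suc t)
  from Suc.prems(1) have "p \<in> ideal_mult (edge_ideal G) (ideal_power (edge_ideal G) t)"
    by simp
  then show ?case
    using Suc.prems(2)
  proof (rule keys_ideal_mult[where P = "\<lambda>v. edge_cover G 1 (lookup v)"
        and Q = "\<lambda>v. edge_cover G t (lookup v)"])
    show "edge_cover G 1 (lookup v)" if "f \<in> edge_ideal G" "v \<in> keys f"
      for f :: "('n, 'k) mpoly" and v
      using keys_edge_ideal[OF assms(1) that] .
    show "edge_cover G (Suc t) (lookup (u + w))" if "edge_cover G (Suc t) (lookup u)" for u w
      using that by (rule edge_cover_mono) (simp add: lookup_add)
    show "edge_cover G (Suc t) (lookup (v + w))"
      if "edge_cover G 1 (lookup v)" "edge_cover G t (lookup w)" for v w
      using edge_cover_add[OF that] by (simp add: lookup_add[abs_def])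
  qed (rule Suc.IH)
qed

text \<open>One edge is peeled off the cover and its monomial divided out. The quotient lies in the
  next lower power by induction, and multiplying the edge monomial back raises the power by
  one.\<close>

lemma single_mem_ideal_power_edge_ideal:
  assumes G: "simple_graph G" and u: "edge_cover G t (lookup u)"
  shows "(single u 1 :: ('n::finite, 'k::comm_ring_1) mpoly) \<in> ideal_power (edge_ideal G) t"
  using u
proof (induction t arbitrary: u)
  case 0
  then show ?case by simp
next
  case (Suc t)
  then obtain M where M: "size M = Suc t" "set_mset M \<subseteq> edges G"
      "\<And>v. cover_deg M v \<le> lookup u v"
    unfolding edge_cover_def by blast
  then obtain e N where N: "M = add_mset e N" "size N = t"
    using size_eq_Suc_imp_eq_union[of M t] by auto
  with M(2) have e: "e \<in> edges G" by simp
  with G obtain i j where ij: "e = {i, j}" "i \<noteq> j"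
    by (auto simp: simple_graph_def card_2_iff)
  \<comment> \<open>The exponent vector of the edge monomial of \<open>e\<close>.\<close>
  define d where "d = single i (1::nat) + single j 1"
  have d: "lookup d v = (if v \<in> e then 1 else 0)" for v
    using ij by (auto simp: d_def lookup_add lookup_single when_def)
  \<comment> \<open>Used twice: \<open>N\<close> fits below \<open>u - d\<close>, and
    \<open>d\<close> is below \<open>u\<close>, so that the truncated subtraction
    \<open>u - d\<close> is exact.\<close>
  have le: "lookup d v + cover_deg N v \<le> lookup u v" for v
    using M(3)[of v] N(1) by (simp add: d)
  have "edge_cover G t (lookup (u - d))"
    unfolding edge_cover_def
  proof (intro exI conjI allI)
    show "cover_deg N v \<le> lookup (u - d) v" for v
      using le[of v] by (simp add: lookup_minus)
  qed (use M(2) N in auto)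
  then have "(single (u - d) 1 :: ('n, 'k) mpoly) \<in> ideal_power (edge_ideal G) t"
    by (rule Suc.IH)
  moreover have "(var i * var j :: ('n, 'k) mpoly) \<in> edge_ideal G"
    unfolding edge_ideal_def using e ij by (intro ring_ideal.span_base) auto
  ultimately have "var i * var j * single (u - d) (1 :: 'k) \<in>
      ideal_power (edge_ideal G) (Suc t)"
    by (simp add: ideal_mult_mem)
  moreover have "d + (u - d) = u"
    using add_leD1[OF le] by (intro poly_mapping_eqI) (simp add: lookup_add lookup_minus)
  ultimately show ?case
    by (simp only: var_def mult_single mult_1 d_def[symmetric])
qed

text \<open>Powers of the edge ideal are monomial ideals: a polynomial belongs to one as soon as all
  its monomials do, which reduces membership to exponent vectors.\<close>

lemma mem_ideal_power_edge_ideal_iff: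
  fixes p :: "('n::finite, 'k::comm_ring_1) mpoly"
  assumes "simple_graph G"
  shows "p \<in> ideal_power (edge_ideal G) t \<longleftrightarrow> (\<forall>u\<in>keys p. edge_cover G t (lookup u))"
proof
  assume "p \<in> ideal_power (edge_ideal G) t"
  then show "\<forall>u\<in>keys p. edge_cover G t (lookup u)"
    using keys_ideal_power_edge_ideal[OF assms] by (intro ballI)
next
  assume u: "\<forall>u\<in>keys p. edge_cover G t (lookup u)"
  show "p \<in> ideal_power (edge_ideal G) t"
    using subspace_ideal_power
  proof (rule single_mem_imp_mem)
    fix v assume "v \<in> keys p"
    then show "single v 1 \<in> ideal_power (edge_ideal G) t"
      using u by (intro single_mem_ideal_power_edge_ideal[OF assms]) (rule bspec)
  qed
qed

lemma monomial_mem_ideal_power_edge_ideal_iff: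
  assumes "simple_graph G"
  shows "(monomial a :: ('n::finite, 'k::comm_ring_1) mpoly) \<in> ideal_power (edge_ideal G) t \<longleftrightarrow>
    edge_cover G t a"
  by (simp add: mem_ideal_power_edge_ideal_iff[OF assms] monomial_eq_single)

section \<open>The saturation\<close>

text \<open>Total degree is additive on exponent vectors and each variable has degree 1, so every
  factor from the maximal ideal adds at least 1.\<close>

lemma keys_ideal_power_max_ideal:
  fixes p :: "('n::finite, 'k::comm_ring_1) mpoly"
  assumes "p \<in> ideal_power max_ideal m" and "u \<in> keys p"
  shows "m \<le> (\<Sum>i\<in>UNIV. lookup u i)"
  using assms
proof (induction m arbitrary: p u)
  case 0
  then show ?case by simp
next
  case (Suc m)
  have "(max_ideal :: ('n, 'k) mpoly set) \<subseteq> {p. \<forall>u\<in>keys p. 1 \<le> (\<Sum>i\<in>UNIV. lookup u i)}"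
    unfolding max_ideal_def
  proof (rule ring_ideal.span_minimal)
    show "{var i | i. True} \<subseteq> {p :: ('n, 'k) mpoly. \<forall>u\<in>keys p. 1 \<le> (\<Sum>i\<in>UNIV. lookup u i)}"
      by (auto simp: var_def lookup_single when_def)
  qed (rule subspace_keys, simp add: lookup_add sum.distrib)
  moreover from Suc.prems(1) have "p \<in> ideal_mult max_ideal (ideal_power max_ideal m)"
    by simp
  ultimately show ?case
    using Suc.prems(2) Suc.IH
    by (elim keys_ideal_mult[where P = "\<lambda>u. 1 \<le> (\<Sum>i\<in>UNIV. lookup u i)"
          and Q = "\<lambda>u. m \<le> (\<Sum>i\<in>UNIV. lookup u i)"])
      (auto simp: lookup_add sum.distrib)
qed

text \<open>Dropping the bound at \<open>i\<close> models multiplication of the monomial by an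
  arbitrarily high power of the variable \<open>i\<close>.\<close>

definition edge_cover_off :: "'v graph \<Rightarrow> nat \<Rightarrow> ('v \<Rightarrow> nat) \<Rightarrow> 'v \<Rightarrow> bool" where
  "edge_cover_off G t u i \<longleftrightarrow>
     (\<exists>M. size M = t \<and> set_mset M \<subseteq> edges G \<and> (\<forall>v. v \<noteq> i \<longrightarrow> cover_deg M v \<le> u v))"

text \<open>A family of \<open>t\<close> edges uses \<open>i\<close> at most \<open>t\<close> times,
  so the exponent \<open>t\<close> at \<open>i\<close> already acts as no bound.\<close>

lemma edge_cover_off_imp_edge_cover:
  assumes "edge_cover_off G t u i" and "\<And>v. u v \<le> w v" and "t \<le> w i"
  shows "edge_cover G t w"
proof -
  obtain M where M: "size M = t" "set_mset M \<subseteq> edges G" "\<And>v. v \<noteq> i \<Longrightarrow> cover_deg M v \<le> u v"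
    using assms(1) unfolding edge_cover_off_def by blast
  have "cover_deg M v \<le> w v" for v
    using M(1) M(3)[of v] assms(2)[of v] assms(3) cover_deg_le_size[of M v]
    by (cases "v = i") auto
  with M show ?thesis
    unfolding edge_cover_def by blast
qed

lemma monomial_mem_saturation_iff:
  fixes G :: "'n::finite graph"
  assumes G: "simple_graph G"
  shows "(monomial a :: ('n, 'k::comm_ring_1) mpoly) \<in> saturation (ideal_power (edge_ideal G) t) \<longleftrightarrow>
    (\<forall>i. edge_cover_off G t a i)"
    (is "?x \<in> _ \<longleftrightarrow> _")
proof
  assume "?x \<in> saturation (ideal_power (edge_ideal G) t)"
  then obtain m where m: "\<And>g :: ('n, 'k) mpoly. g \<in> ideal_power max_ideal m \<Longrightarrow>
      ?x * g \<in> ideal_power (edge_ideal G) t"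
    by (auto simp: saturation_def ideal_quotient_def)
  show "\<forall>i. edge_cover_off G t a i"
  proof
    fix i
    have "(var i :: ('n, 'k) mpoly) \<in> max_ideal"
      unfolding max_ideal_def by (rule ring_ideal.span_base) blast
    \<comment> \<open>Testing against this single element suffices: it raises the exponent at
      \<open>i\<close> and leaves all others unchanged.\<close>
    then have "?x * var i ^ m \<in> ideal_power (edge_ideal G) t"
      by (intro m power_mem_ideal_power)
    then have "edge_cover G t (lookup (mono_exp a + single i m))"
      by (simp add: mem_ideal_power_edge_ideal_iff[OF G] monomial_eq_single var_power mult_single)
    then show "edge_cover_off G t a i"
      unfolding edge_cover_def edge_cover_off_def
      by (auto simp: lookup_add lookup_single when_def)
         (metis add.right_neutral)
  qed
next
  assume off: "\<forall>i. edge_cover_off G t a i"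
  \<comment> \<open>Pigeonhole: total degree above \<open>card UNIV * t\<close> forces some exponent
    to be at least \<open>t\<close>. The successor gives strictness and also
    \<open>m \<ge> 1\<close>, which \<open>saturation\<close> requires.\<close>
  define m where "m = Suc (card (UNIV :: 'n set) * t)"
  have "?x * g \<in> ideal_power (edge_ideal G) t" if g: "g \<in> ideal_power max_ideal m" for g
    unfolding mem_ideal_power_edge_ideal_iff[OF G]
  proof
    fix u assume "u \<in> keys (?x * g)"
    then obtain w where w: "u = mono_exp a + w" "w \<in> keys g"
      using keys_mult[of ?x g] by (auto simp: monomial_eq_single)
    have "\<exists>i. t \<le> lookup w i"
    proof (rule ccontr)
      assume "\<nexists>i. t \<le> lookup w i"
      then have "(\<Sum>i\<in>UNIV. lookup w i) \<le> (\<Sum>i\<in>(UNIV :: 'n set). t)"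
        by (intro sum_mono) (meson nle_le)
      also have "\<dots> < m" by (simp add: m_def)
      finally show False
        using keys_ideal_power_max_ideal[OF g w(2)] by simp
    qed
    then obtain i where "t \<le> lookup w i" by blast
    with off w(1) show "edge_cover G t (lookup u)"
      by (intro edge_cover_off_imp_edge_cover[of G t a i]) (auto simp: lookup_add)
  qed
  then show "?x \<in> saturation (ideal_power (edge_ideal G) t)"
    unfolding saturation_def ideal_quotient_def by (intro UN_I[of m]) (auto simp: m_def)
qed

section \<open>Matching numbers\<close>

lemma is_matching_subset:
  assumes "is_matching W M" and "N \<subseteq># M"
  shows "is_matching W N"
  using assms cover_deg_mono[OF assms(2)] set_mset_mono[OF assms(2)]
  unfolding is_matching_def cover_deg_def[symmetric] by (meson order_trans)

text \<open>Replaces the maximum by the existence of a matching of exactly the given size: a larger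
  matching can be trimmed, since submultisets of matchings are matchings.\<close>

lemma le_matching_number_iff:
  assumes "weighted_graph W"
  shows "t \<le> matching_number W \<longleftrightarrow> (\<exists>M. is_matching W M \<and> size M = t)"
proof -
  \<comment> \<open>Makes the set of sizes nonempty, as \<open>Max_ge_iff\<close> demands.\<close>
  have "is_matching W {#}"
    by (simp add: is_matching_def)
  then have "t \<le> matching_number W \<longleftrightarrow> (\<exists>M. is_matching W M \<and> t \<le> size M)"
    unfolding matching_number_def using finite_matching_sizes[OF assms]
    by (subst Max_ge_iff) blast+
  then show ?thesis
    using exists_submultiset_size is_matching_subset by (metis order_refl)
qed

text \<open>Restricting to vertices of positive weight is encoded by the degree bounds: an edge of
  \<open>M\<close> through \<open>v\<close> makes \<open>cover_deg M v\<close> positive, and hence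
  \<open>a v\<close>.\<close>

lemma is_matching_weighted_subgraph_iff:
  assumes "simple_graph G" and "verts G = UNIV"
  shows "is_matching (weighted_subgraph G a) M \<longleftrightarrow>
    set_mset M \<subseteq> edges G \<and> (\<forall>v. cover_deg M v \<le> a v)"
proof
  assume M: "is_matching (weighted_subgraph G a) M"
  have "cover_deg M v \<le> a v" for v
  proof (cases "a v > 0")
    case True
    with M assms(2) show ?thesis
      by (auto simp: is_matching_def weighted_subgraph_def supp_verts_def cover_deg_def)
  next
    case False
    have "v \<notin> e" if "e \<in># M" for e
    proof -
      have "e \<subseteq> supp_verts G a"
        using M that by (auto simp: is_matching_def weighted_subgraph_def)
      with False show ?thesis by (auto simp: supp_verts_def)
    qed
    then show ?thesis
      by (simp add: cover_deg_eq_0)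
  qed
  with M show "set_mset M \<subseteq> edges G \<and> (\<forall>v. cover_deg M v \<le> a v)"
    by (auto simp: is_matching_def weighted_subgraph_def)
next
  assume M: "set_mset M \<subseteq> edges G \<and> (\<forall>v. cover_deg M v \<le> a v)"
  then have "a v > 0" if "e \<in># M" "v \<in> e" for e v
    using cover_deg_pos[OF that] by (meson less_le_trans)
  with M assms(2) show "is_matching (weighted_subgraph G a) M"
    by (auto simp: is_matching_def weighted_subgraph_def supp_verts_def cover_deg_def)
qed

lemma le_matching_number_weighted_subgraph_iff:
  assumes "simple_graph G" and "verts G = UNIV"
  shows "t \<le> matching_number (weighted_subgraph G a) \<longleftrightarrow> edge_cover G t a"
  using le_matching_number_iff[OF weighted_graph_weighted_subgraph[OF assms(1)]]
    is_matching_weighted_subgraph_iff[OF assms]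
  by (auto simp: edge_cover_def)

text \<open>The weight bound at vertices of \<open>N\<close> is lost in the smaller graph, but it
  holds there trivially, since no edge of \<open>M\<close> meets \<open>N\<close>.\<close>

lemma is_matching_remove_verts_iff:
  assumes "weighted_graph W"
  shows "is_matching (remove_verts W N) M \<longleftrightarrow> is_matching W M \<and> (\<forall>e\<in>#M. e \<inter> N = {})"
proof
  assume M: "is_matching (remove_verts W N) M"
  then have N: "\<forall>e\<in>#M. e \<inter> N = {}"
    by (auto simp: is_matching_def remove_verts_def)
  have "cover_deg M v \<le> weight W v" if "v \<in> verts W" for v
  proof (cases "v \<in> N")
    case True
    with N have "cover_deg M v = 0" by (intro cover_deg_eq_0) blast
    then show ?thesis by simp
  next
    case False
    with M that show ?thesis by (simp add: is_matching_def remove_verts_def cover_deg_def)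
  qed
  with M N show "is_matching W M \<and> (\<forall>e\<in>#M. e \<inter> N = {})"
    by (auto simp: is_matching_def remove_verts_def cover_deg_def)
next
  assume "is_matching W M \<and> (\<forall>e\<in>#M. e \<inter> N = {})"
  with assms show "is_matching (remove_verts W N) M"
    by (fastforce simp: is_matching_def remove_verts_def weighted_graph_def simple_graph_def)
qed

text \<open>Upper bound: the edges of \<open>M\<close> meeting the neighbourhood \<open>N\<close>
  number at most the degree, and the others form a matching away from \<open>N\<close>. Lower bound:
  a star centred at \<open>i\<close> that exhausts the weights on \<open>N\<close> is added to a
  maximum matching away from \<open>N\<close>.\<close>

lemma edge_cover_off_iff:
  fixes G :: "'n::finite graph" and a :: "'n \<Rightarrow> nat"
  assumes G: "simple_graph G" "verts G = UNIV"
  defines "W \<equiv> weighted_subgraph G a"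
  shows "edge_cover_off G t a i \<longleftrightarrow>
    t \<le> matching_number (remove_verts W (supp_nbhd G a i)) + wdegree G a i"
proof -
  define N where "N = supp_nbhd G a i"
  have W: "weighted_graph W"
    unfolding W_def using G(1) by (rule weighted_graph_weighted_subgraph)
  have mem_N: "j \<in> N \<longleftrightarrow> a j > 0 \<and> {i, j} \<in> edges G" for j
    using G(2) by (simp add: N_def supp_nbhd_def supp_verts_def)
  have no_loop: "{v} \<notin> edges G" for v
    using G(1) by (force simp: simple_graph_def)
  have matching: "is_matching (remove_verts W N) M \<longleftrightarrow>
      set_mset M \<subseteq> edges G \<and> (\<forall>v. cover_deg M v \<le> a v) \<and> (\<forall>e\<in>#M. e \<inter> N = {})" for M
    using is_matching_remove_verts_iff[OF W] is_matching_weighted_subgraph_iff[OF G]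
    by (auto simp: W_def)
  have le: "s \<le> matching_number (remove_verts W N) \<longleftrightarrow>
      (\<exists>M. is_matching (remove_verts W N) M \<and> size M = s)" for s
    by (rule le_matching_number_iff[OF weighted_graph_remove_verts[OF W]])
  have deg: "wdegree G a i = (\<Sum>j\<in>N. a j)"
    by (simp add: wdegree_def N_def)
  have "t \<le> matching_number (remove_verts W N) + wdegree G a i" if "edge_cover_off G t a i"
  proof -
    obtain M where M: "size M = t" "set_mset M \<subseteq> edges G"
        "\<And>v. v \<noteq> i \<Longrightarrow> cover_deg M v \<le> a v"
      using \<open>edge_cover_off G t a i\<close> unfolding edge_cover_off_def by blast
    define A where "A = {#e \<in># M. e \<inter> N \<noteq> {}#}"
    define B where "B = {#e \<in># M. e \<inter> N = {}#}"
    have M_eq: "M = A + B"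
      unfolding A_def B_def by (simp add: multiset_partition add.commute)
    have "size A \<le> (\<Sum>v\<in>N. cover_deg A v)"
      by (rule size_le_sum_cover_deg) (auto simp: A_def)
    also have "\<dots> \<le> (\<Sum>v\<in>N. a v)"
    \<comment> \<open>Without loops \<open>i\<close> is not in \<open>N\<close>, so the bounds at
      all vertices of \<open>N\<close> are available.\<close>
    proof (rule sum_mono)
      fix v assume "v \<in> N"
      then have "v \<noteq> i"
        using no_loop by (auto simp: mem_N)
      then show "cover_deg A v \<le> a v"
        using M(3)[of v] by (simp add: M_eq)
    qed
    finally have A: "size A \<le> wdegree G a i" by (simp add: deg)
    \<comment> \<open>The other end of an edge of \<open>M\<close> through \<open>i\<close> is used
      by \<open>M\<close>, so it has positive weight and lies in \<open>N\<close>; such an edge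
      belongs to \<open>A\<close>, not to \<open>B\<close>.\<close>
    have "i \<notin> e" if e: "e \<in># B" for e
    proof
      assume "i \<in> e"
      have "e \<in># M" "e \<in> edges G" using e M(2) by (auto simp: B_def)
      with G(1) obtain x y where "e = {x, y}" "x \<noteq> y"
        by (auto simp: simple_graph_def card_2_iff)
      with \<open>i \<in> e\<close> obtain j where j: "e = {i, j}" "j \<noteq> i"
        by (cases "i = x") auto
      with \<open>e \<in># M\<close> have "a j > 0"
        using cover_deg_pos[of e M j] M(3)[of j] by auto
      with j \<open>e \<in> edges G\<close> have "j \<in> N" by (simp add: mem_N)
      with e j show False by (auto simp: B_def)
    qed
    then have "cover_deg B i = 0"
      by (rule cover_deg_eq_0)
    \<comment> \<open>The missing bound at \<open>i\<close> is restored, because \<open>B\<close>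
      does not use \<open>i\<close> at all.\<close>
    then have "cover_deg B v \<le> a v" for v
      using M(3)[of v] by (cases "v = i") (auto simp: M_eq)
    then have "is_matching (remove_verts W N) B"
      unfolding matching using M(2) by (auto simp: B_def)
    then have "size B \<le> matching_number (remove_verts W N)"
      using le by blast
    with A M(1) show ?thesis by (simp add: M_eq)
  qed
  moreover have "edge_cover_off G t a i" if "t \<le> matching_number (remove_verts W N) + wdegree G a i"
  proof -
    \<comment> \<open>Taking \<open>s\<close> in \<open>le\<close> to be the matching number itself
      yields a maximum matching.\<close>
    obtain B where B: "is_matching (remove_verts W N) B" "size B = matching_number (remove_verts W N)"
      using le by blast
    \<comment> \<open>The star at \<open>i\<close>: each neighbour \<open>j\<close> is used to its
      full weight, and only the unbounded vertex \<open>i\<close> is used repeatedly beyond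
      that.\<close>
    define S where "S = (\<Sum>j\<in>N. replicate_mset (a j) {i, j})"
    have "size S = wdegree G a i"
      by (simp add: S_def deg)
    with that B(2) obtain M where M: "M \<subseteq># S + B" "size M = t"
      using exists_submultiset_size[of t "S + B"] by auto
    have "set_mset M \<subseteq> set_mset S \<union> set_mset B"
      using set_mset_mono[OF M(1)] by simp
    moreover have "set_mset S \<subseteq> edges G"
      by (auto simp: S_def set_mset_sum mem_N split: if_splits)
    moreover have "set_mset B \<subseteq> edges G"
      using B(1) unfolding matching by (rule conjunct1)
    ultimately have "set_mset M \<subseteq> edges G"
      by (meson Un_least order_trans)
    moreover have "cover_deg M v \<le> a v" if "v \<noteq> i" for v
    proof -
      have S: "cover_deg S v = (if v \<in> N then a v else 0)"
        using that by (simp add: S_def cover_deg_sum cover_deg_replicate)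
      \<comment> \<open>Away from \<open>i\<close>, the star \<open>S\<close> uses only vertices of
        \<open>N\<close> and \<open>B\<close> only vertices outside \<open>N\<close>, so their
        degrees never accumulate at a vertex.\<close>
      have "cover_deg B v \<le> a v" and "v \<in> N \<Longrightarrow> cover_deg B v = 0"
        using B(1) unfolding matching by (auto simp: cover_deg_def)
      with S have "cover_deg (S + B) v \<le> a v" by simp
      with cover_deg_mono[OF M(1), of v] show ?thesis by simp
    qed
    ultimately show ?thesis
      unfolding edge_cover_off_def using M(2) by blast
  qed
  ultimately show ?thesis
    unfolding N_def by blast
qed

theorem theorem2p1:
  fixes G :: "'n::finite graph"
    and I :: "('n, 'k::field) mpoly set"
    and t :: nat
    and a :: "'n \<Rightarrow> nat"
  assumes "simple_graph G" and "verts G = UNIV"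
    and "I = edge_ideal G"
    and "t \<ge> 1"
  shows "monomial a \<in> saturation (ideal_power I t) - ideal_power I t \<longleftrightarrow>
           matching_number (weighted_subgraph G a) < t \<and>
           (\<forall>i\<in>verts G.
              int (matching_number (remove_verts (weighted_subgraph G a) (supp_nbhd G a i)))
                \<ge> int t - int (wdegree G a i))"
proof -
  have "monomial a \<in> ideal_power I t \<longleftrightarrow> \<not> matching_number (weighted_subgraph G a) < t"
    using assms(1-3) monomial_mem_ideal_power_edge_ideal_iff[of G a t]
      le_matching_number_weighted_subgraph_iff[of G t a] by (auto simp: not_less)
  moreover have "monomial a \<in> saturation (ideal_power I t) \<longleftrightarrow>
      (\<forall>i\<in>verts G.
        int (matching_number (remove_verts (weighted_subgraph G a) (supp_nbhd G a i)))
          \<ge> int t - int (wdegree G a i))"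
  proof -
    \<comment> \<open>The difference is taken in the integers, where it is negative if the degree
      exceeds \<open>t\<close>; moving the degree across turns the condition into the natural number
      inequality of \<open>edge_cover_off_iff\<close>.\<close>
    have "edge_cover_off G t a i \<longleftrightarrow>
        int (matching_number (remove_verts (weighted_subgraph G a) (supp_nbhd G a i)))
          \<ge> int t - int (wdegree G a i)" for i
      using edge_cover_off_iff[OF assms(1,2), of t a i] by linarith
    then show ?thesis
      by (simp add: assms(2,3) monomial_mem_saturation_iff[OF assms(1)])
  qed
  ultimately show ?thesis by blast
qed

end
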